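(* Let $\infty\ge p\ge q\ge 1$ and let $A\in\mathbb C^{2\times 2}$ be a constant matrix. Suppose that $A$ is invertible and that the system $x'=Ax$, $t\ge 0$, admits an exponential expansion on $[0,\infty)$. Then any $(L^p,L^q)$ Hyers-Ulam stability constant (HUS constant) $L$ of $x'=Ax$ satisfies \[ L\ge\begin{cases} \dfrac{|A^{-1}u|\,(q\gamma)^{\frac1q}}{|(\gamma A^{-1}+I_2)u|\,(p\gamma)^{\frac1p}} & \text{if } p<\infty,\\[2ex] \dfrac{|A^{-1}u|\,(q\gamma)^{\frac1q}}{|(\gamma A^{-1}+I_2)u|} & \text{if } p=\infty \text{ and } q\in[1,\infty),\\[2ex] \dfrac{|A^{-1}u|}{|(\gamma A^{-1}+I_2)u|} & \text{if } p=q=\infty, \end{cases} \] for every unit vector $u\in\mathbb C^2$ and every constant $\gamma>0$, where $I_2$ is the $2\times 2$ identity matrix.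
   Context: On $\mathbb C^2$ the norm is the maximum norm $|v|=|v|_\infty=\max\{|v_1|,|v_2|\}$, and $\|\Phi\|_\infty=\max\{|\phi_{11}|+|\phi_{12}|,|\phi_{21}|+|\phi_{22}|\}$ is the corresponding operator norm of a matrix $\Phi=(\phi_{ij})\in\mathbb C^{2\times2}$. $T(t,s)$, $t,s\ge0$, denotes the evolution family of $x'=Ax$ (so $T(t,s)=e^{A(t-s)}$). The system $x'=Ax$ admits an exponential expansion on $[0,\infty)$ if there exist $D,\lambda>0$ such that $\|T(t,s)\|_\infty\le De^{-\lambda(s-t)}$ for all $0\le t\le s$. For $p\in[1,\infty)$, $\|x\|_{L^p([0,\infty),\mathbb C^2)}:=\left(\int_0^\infty|x(t)|^p\,dt\right)^{1/p}$, and $\|x\|_{L^\infty([0,\infty),\mathbb C^2)}:=\operatorname{ess\,sup}_{t\ge0}|x(t)|$; $L^p([0,\infty),\mathbb C^2)$ consists of the measurable functions with finite norm. HUS constant: a number $L>0$ is an $(L^p,L^q)$ Hyers-Ulam stability (HUS) constant of $x'=Ax$ if for each $\varepsilon>0$ and each continuously differentiable $y\colon[0,\infty)\to\mathbb C^2$ satisfying $y'-Ay\in L^q([0,\infty),\mathbb C^2)$ and $\|y'-Ay\|_{L^q([0,\infty),\mathbb C^2)}\le\varepsilon$, there exists a solution $x\colon[0,\infty)\to\mathbb C^2$ of $x'=Ax$ such that $x-y\in L^p([0,\infty),\mathbb C^2)$ and $\|x-y\|_{L^p([0,\infty),\mathbb C^2)}\le L\varepsilon$. *)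

theory Defs
  imports "HOL-Analysis.Analysis" "HOL-Probability.Essential_Supremum"
begin

text \<open>
  The maximum norm of complex moduli. The type-class norm on \<^typ>\<open>complex^2\<close> is Euclidean, and
  \<^const>\<open>infnorm\<close> takes the maximum over real and imaginary parts separately.
\<close>

definition max_norm :: "complex^2 \<Rightarrow> real" where
  "max_norm v = max (cmod (v$1)) (cmod (v$2))"

definition max_opnorm :: "complex^2^2 \<Rightarrow> real" where
  "max_opnorm \<Phi> = max (cmod (\<Phi>$1$1) + cmod (\<Phi>$1$2)) (cmod (\<Phi>$2$1) + cmod (\<Phi>$2$2))"

text \<open>
  Multiplication in the type class instance of \<^typ>\<open>'a^'n\<close> is componentwise, so neither \<open>^\<close> nor
  \<^const>\<open>exp\<close> gives the matrix operation.
\<close>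

definition mat_pow :: "complex^2^2 \<Rightarrow> nat \<Rightarrow> complex^2^2" where
  "mat_pow A n = (((**) A) ^^ n) (mat 1)"

definition mat_exp :: "complex^2^2 \<Rightarrow> complex^2^2" where
  "mat_exp A = (\<Sum>n. mat_pow A n /\<^sub>R fact n)"

definition evolution :: "complex^2^2 \<Rightarrow> real \<Rightarrow> real \<Rightarrow> complex^2^2" where
  "evolution A t s = mat_exp ((t - s) *\<^sub>R A)"

definition exponential_expansion :: "complex^2^2 \<Rightarrow> bool" where
  "exponential_expansion A \<longleftrightarrow>
     (\<exists>D>0. \<exists>\<mu>>0. \<forall>t s. 0 \<le> t \<and> t \<le> s \<longrightarrow> max_opnorm (evolution A t s) \<le> D * exp (- \<mu> * (s - t)))"

text \<open>
  Functions on \<open>[0, \<infinity>)\<close> are total functions on \<^typ>\<open>real\<close> whose values at negative arguments are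
  irrelevant. The extended norm takes the value \<open>\<infinity>\<close> outside of the space; the integral is
  separated by cases because there is no \<open>powr\<close> on \<^typ>\<open>ennreal\<close>.
\<close>

definition Lp_norm :: "ennreal \<Rightarrow> (real \<Rightarrow> complex^2) \<Rightarrow> ennreal" where
  "Lp_norm p f =
     (if p = \<infinity> then esssup (lebesgue_on {0..}) (\<lambda>t. ennreal (max_norm (f t)))
      else let I = (\<integral>\<^sup>+ t. ennreal (max_norm (f t) powr enn2real p) \<partial>lebesgue_on {0..})
           in if I = \<infinity> then \<infinity> else ennreal (enn2real I powr (1 / enn2real p)))"

definition Lp_space :: "ennreal \<Rightarrow> (real \<Rightarrow> complex^2) set" where
  "Lp_space p = {f \<in> borel_measurable (lebesgue_on {0..}). Lp_norm p f < \<infinity>}"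

definition is_solution :: "complex^2^2 \<Rightarrow> (real \<Rightarrow> complex^2) \<Rightarrow> bool" where
  "is_solution A x \<longleftrightarrow> (\<forall>t\<ge>0. (x has_vector_derivative A *v x t) (at t within {0..}))"

definition HUS_constant :: "ennreal \<Rightarrow> ennreal \<Rightarrow> complex^2^2 \<Rightarrow> real \<Rightarrow> bool" where
  "HUS_constant p q A L \<longleftrightarrow> L > 0 \<and>
     (\<forall>\<epsilon>>0. \<forall>y y'.
        (\<forall>t\<ge>0. (y has_vector_derivative y' t) (at t within {0..})) \<and> continuous_on {0..} y' \<and>
        (\<lambda>t. y' t - A *v y t) \<in> Lp_space q \<and> Lp_norm q (\<lambda>t. y' t - A *v y t) \<le> ennreal \<epsilon>
        \<longrightarrow> (\<exists>x. is_solution A x \<and> (\<lambda>t. x t - y t) \<in> Lp_space p \<and>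
               Lp_norm p (\<lambda>t. x t - y t) \<le> ennreal (L * \<epsilon>)))"

text \<open>The exponential series converges and \<^const>\<open>evolution\<close> solves the system.\<close>

lemma mat_pow_0 [simp]: "mat_pow A 0 = mat 1"
  and mat_pow_Suc: "mat_pow A (Suc n) = A ** mat_pow A n"
  by (simp_all add: mat_pow_def)

lemma mat_pow_scaleR: "mat_pow (r *\<^sub>R A) n = r ^ n *\<^sub>R mat_pow A n"
  by (induction n)
     (simp_all add: mat_pow_Suc matrix_matrix_mult_def vec_eq_iff sum_2 scaleR_conv_of_real[where 'a=complex] algebra_simps)

lemma mat_pow_entry_bound:
  "cmod (mat_pow A n $ i $ j) \<le> (max_opnorm A) ^ n"
proof (induction n arbitrary: i j)
  case 0
  then show ?case by (simp add: mat_def)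
next
  case (Suc n)
  have nn: "0 \<le> max_opnorm A ^ n"
    using Suc[of 1 1] norm_ge_zero order_trans by blast
  have row: "cmod (A$i$1) + cmod (A$i$2) \<le> max_opnorm A"
    using exhaust_2[of i] by (auto simp: max_opnorm_def)
  have "cmod (mat_pow A (Suc n) $ i $ j)
      \<le> cmod (A$i$1) * cmod (mat_pow A n $ 1 $ j) + cmod (A$i$2) * cmod (mat_pow A n $ 2 $ j)"
    by (simp add: mat_pow_Suc matrix_matrix_mult_def sum_2 norm_mult [symmetric] norm_triangle_ineq)
  also have "\<dots> \<le> cmod (A$i$1) * max_opnorm A ^ n + cmod (A$i$2) * max_opnorm A ^ n"
    by (intro add_mono mult_left_mono Suc) auto
  also have "\<dots> \<le> max_opnorm A * max_opnorm A ^ n"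
    using mult_right_mono[OF row nn] by (simp add: algebra_simps)
  finally show ?case by simp
qed

lemma summable_mat_exp_entry: "summable (\<lambda>n. mat_pow A n $ i $ j / fact n * z ^ n)"
proof (rule summable_comparison_test')
  show "summable (\<lambda>n. inverse (fact n) * (max_opnorm A * cmod z) ^ n)"
    by (rule summable_exp)
  fix n :: nat
  show "norm (mat_pow A n $ i $ j / fact n * z ^ n) \<le> inverse (fact n) * (max_opnorm A * cmod z) ^ n"
    using mult_right_mono[OF mat_pow_entry_bound[of A n i j], of "cmod z ^ n / fact n"]
    by (simp add: norm_mult norm_divide norm_power power_mult_distrib field_simps)
qed

lemma vec_sums_iff: "f sums l \<longleftrightarrow> (\<forall>i. (\<lambda>n. f n $ i) sums (l $ i))"
  for f :: "nat \<Rightarrow> 'a::real_normed_vector ^ 'n"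
  unfolding sums_def 
proof (intro iffI allI)
  fix i assume "(\<lambda>n. sum f {..<n}) \<longlonglongrightarrow> l"
  then show "(\<lambda>n. \<Sum>k<n. f k $ i) \<longlonglongrightarrow> l $ i"
    using tendsto_vec_nth[of "\<lambda>n. sum f {..<n}" l sequentially i] by simp
next
  assume "\<forall>i. (\<lambda>n. \<Sum>k<n. f k $ i) \<longlonglongrightarrow> l $ i"
  then show "(\<lambda>n. sum f {..<n}) \<longlonglongrightarrow> l"
    by (intro vec_tendstoI) simp
qed

lemma mat_exp_entry_sums:
  "(\<lambda>n. mat_pow A n $ i $ j / fact n * of_real t ^ n) sums (mat_exp (t *\<^sub>R A) $ i $ j)"
proof -
  have "(\<lambda>n. mat_pow (t *\<^sub>R A) n /\<^sub>R fact n) sums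
      (\<chi> i j. \<Sum>n. mat_pow A n $ i $ j / fact n * of_real t ^ n)"
    unfolding vec_sums_iff
    using summable_mat_exp_entry[THEN summable_sums, of A _ _ "of_real t"]
    by (simp add: mat_pow_scaleR scaleR_conv_of_real[where 'a=complex] divide_inverse mult_ac)
  then have "mat_exp (t *\<^sub>R A) = (\<chi> i j. \<Sum>n. mat_pow A n $ i $ j / fact n * of_real t ^ n)"
    unfolding mat_exp_def by (rule sums_unique[symmetric])
  then show ?thesis
    using summable_mat_exp_entry[THEN summable_sums, of A i j "of_real t"] by simp
qed

lemma mat_exp_sums: "(\<lambda>n. mat_pow A n /\<^sub>R fact n) sums mat_exp A"
  unfolding vec_sums_iff using mat_exp_entry_sums[of A _ _ 1]
  by (simp add: scaleR_conv_of_real[where 'a=complex] divide_inverse mult_ac)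

lemma evolution_refl: "evolution A s s = mat 1"
proof -
  have "mat_exp (0 *\<^sub>R A) $ i $ j = (mat 1 :: complex^2^2) $ i $ j" for i j
    using sums_unique2[OF mat_exp_entry_sums[of A i j 0, unfolded of_real_0] powser_sums_zero]
    by simp
  then show ?thesis by (simp add: evolution_def vec_eq_iff)
qed

lemma has_vector_derivative_vec:
  fixes f :: "real \<Rightarrow> 'a::real_normed_vector ^ 'n"
  assumes "\<And>i. ((\<lambda>t. f t $ i) has_vector_derivative f' $ i) (at t)"
  shows "(f has_vector_derivative f') (at t)"
  unfolding has_vector_derivative_def has_derivative_at_within
proof (intro conjI bounded_linear_scaleR_left vec_tendstoI)
  fix i
  show "((\<lambda>y. ((f y - f t - (y - t) *\<^sub>R f') /\<^sub>R norm (y - t)) $ i) \<longlongrightarrow> 0 $ i) (at t)"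
    using assms[of i] unfolding has_vector_derivative_def has_derivative_at_within by simp
qed

lemma evolution_has_vector_derivative:
  "((\<lambda>t. evolution A t s) has_vector_derivative A ** evolution A t s) (at t)"
proof (intro has_vector_derivative_vec)
  fix i j
  define c where "c n = mat_pow A n $ i $ j / fact n" for n
  define F where "F z = (\<Sum>n. c n * z ^ n)" for z
  have summ: "summable (\<lambda>n. c n * z ^ n)" for z
    unfolding c_def by (rule summable_mat_exp_entry)
  have ev: "evolution A t s $ i $ j = F (of_real (t - s))" for t
    unfolding evolution_def F_def c_def using mat_exp_entry_sums[of A i j "t - s"]
    by (simp add: sums_iff)
  let ?z = "of_real (t - s) :: complex"
  have "(F has_field_derivative (\<Sum>n. diffs c n * ?z ^ n)) (at ?z)"
    unfolding F_def by (rule termdiffs_strong_converges_everywhere) (rule summ)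
  moreover have "((\<lambda>t. of_real (t - s) :: complex) has_vector_derivative 1) (at t)"
    unfolding of_real_diff by (auto intro!: derivative_eq_intros)
  ultimately have "((F \<circ> (\<lambda>t. of_real (t - s))) has_vector_derivative 1 * (\<Sum>n. diffs c n * ?z ^ n)) (at t)"
    by (rule field_vector_diff_chain_at[rotated])
  moreover have "diffs c n * ?z ^ n = A$i$1 * (mat_pow A n $ 1 $ j / fact n * ?z ^ n)
      + A$i$2 * (mat_pow A n $ 2 $ j / fact n * ?z ^ n)" for n
    by (simp add: diffs_def c_def mat_pow_Suc matrix_matrix_mult_def sum_2 field_simps
             del: of_nat_Suc)
  moreover have "(\<lambda>n. A$i$1 * (mat_pow A n $ 1 $ j / fact n * ?z ^ n)
      + A$i$2 * (mat_pow A n $ 2 $ j / fact n * ?z ^ n)) sums ((A ** evolution A t s) $ i $ j)"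
    unfolding evolution_def matrix_matrix_mult_def
    by (simp only: sum_2 vec_lambda_beta, intro sums_add sums_mult mat_exp_entry_sums)
  ultimately show "((\<lambda>t. evolution A t s $ i $ j) has_vector_derivative (A ** evolution A t s) $ i $ j) (at t)"
    by (simp add: ev o_def sums_iff)
qed

end

theory Submission
  imports Defs
begin

text \<open>
  One well-chosen approximate solution already forces the bound. For \<open>v = A\<^sup>-\<^sup>1 u\<close> the function
  \<open>y t = exp (- \<gamma> * t) *\<^sub>R v\<close> has the residual \<open>y' - A y = - exp (- \<gamma> * t) *\<^sub>R (\<gamma> A\<^sup>-\<^sup>1 + I) u\<close>, and the
  \<open>L\<^sup>r\<close> norm of a decaying exponential \<open>exp (- \<gamma> * t) *\<^sub>R w\<close> on the half-line is
  \<open>max_norm w / (r * \<gamma>) powr (1 / r)\<close>, or \<open>max_norm w\<close> for \<open>r = \<infinity>\<close> (\<open>Lp_norm_exp_decay\<close>). Taking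
  \<open>\<epsilon>\<close> to be the \<open>L\<^sup>q\<close> norm of the residual, a stability constant \<open>L\<close> provides a solution \<open>x\<close> of
  \<open>x' = A x\<close> at \<open>L\<^sup>p\<close> distance at most \<open>L * \<epsilon>\<close> from \<open>y\<close>.

  The exponential expansion leaves only one candidate for \<open>x\<close>. Since \<open>x t = T(t,s) x s\<close>
  (\<open>solution_eq_evolution\<close>), a decay of \<open>T(t,s)\<close> as \<open>s\<close> grows means that a solution which is nonzero
  somewhere on the half-line tends to infinity in norm (\<open>solution_blow_up\<close>). As \<open>y\<close> is bounded,
  \<open>x - y\<close> would then lie in no \<open>L\<^sup>p\<close> space (\<open>Lp_norm_eq_infinity\<close>). Hence \<open>x = 0\<close>, the
  \<open>L\<^sup>p\<close> norm of \<open>y\<close> itself is at most \<open>L * \<epsilon>\<close>, and dividing by \<open>\<epsilon>\<close> gives the bound.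
\<close>

section \<open>The maximum norm\<close>

lemma max_norm_nonneg [simp]: "0 \<le> max_norm v"
  by (simp add: max_norm_def le_max_iff_disj)

lemma max_norm_zero [simp]: "max_norm 0 = 0"
  by (simp add: max_norm_def)

lemma max_norm_pos: "v \<noteq> 0 \<Longrightarrow> 0 < max_norm v"
  by (auto simp: max_norm_def vec_eq_iff forall_2 less_max_iff_disj)

lemma max_norm_minus [simp]: "max_norm (- v) = max_norm v"
  by (simp add: max_norm_def)

lemma max_norm_scaleR: "max_norm (r *\<^sub>R v) = \<bar>r\<bar> * max_norm v"
  by (simp add: max_norm_def max_mult_distrib_left)

lemma max_norm_diff_ge: "max_norm x - max_norm y \<le> max_norm (x - y)"
proof -
  have "cmod (x$i) \<le> cmod ((x - y)$i) + cmod (y$i)" for i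
    using norm_triangle_ineq[of "(x - y)$i" "y$i"] by simp
  from this[of 1] this[of 2] show ?thesis
    by (simp add: max_norm_def)
qed

lemma max_norm_matrix_vector: "max_norm (\<Phi> *v x) \<le> max_opnorm \<Phi> * max_norm x"
proof -
  have "cmod ((\<Phi> *v x)$i) \<le> (cmod (\<Phi>$i$1) + cmod (\<Phi>$i$2)) * max_norm x" for i
  proof -
    have "cmod ((\<Phi> *v x)$i) \<le> cmod (\<Phi>$i$1) * cmod (x$1) + cmod (\<Phi>$i$2) * cmod (x$2)"
      by (simp add: matrix_vector_mult_def sum_2 norm_mult [symmetric] norm_triangle_ineq)
    also have "\<dots> \<le> cmod (\<Phi>$i$1) * max_norm x + cmod (\<Phi>$i$2) * max_norm x"
      by (intro add_mono mult_left_mono) (auto simp: max_norm_def)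
    finally show ?thesis by (simp add: algebra_simps)
  qed
  moreover have "(cmod (\<Phi>$i$1) + cmod (\<Phi>$i$2)) * max_norm x \<le> max_opnorm \<Phi> * max_norm x" for i
    using exhaust_2[of i] by (intro mult_right_mono) (auto simp: max_opnorm_def)
  ultimately show ?thesis
    unfolding max_norm_def[of "\<Phi> *v x"] by (meson max.bounded_iff order_trans)
qed

lemma continuous_on_max_norm: "continuous_on S max_norm"
  unfolding max_norm_def by (intro continuous_intros)

lemma borel_measurable_max_norm [measurable]: "max_norm \<in> borel_measurable borel"
  by (rule borel_measurable_continuous_onI[OF continuous_on_max_norm])

lemma bounded_bilinear_matrix_vector_mult:
  "bounded_bilinear ((*v) :: complex^2^2 \<Rightarrow> complex^2 \<Rightarrow> complex^2)"
  unfolding bilinear_conv_bounded_bilinear[symmetric] bilinear_def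
  by (auto intro!: linearI simp: matrix_vector_mult_def vec_eq_iff sum_2 algebra_simps)

section \<open>Solutions under an exponential expansion\<close>

lemma mat_pow_commute: "mat_pow A n ** A = A ** mat_pow A n"
  by (induction n) (simp_all add: mat_pow_Suc matrix_mul_assoc [symmetric])

lemma mat_exp_commute: "mat_exp (r *\<^sub>R A) ** A = A ** mat_exp (r *\<^sub>R A)"
proof -
  have l: "bounded_linear (\<lambda>M. A ** M)" and r: "bounded_linear (\<lambda>M. M ** A)"
    unfolding linear_conv_bounded_linear[symmetric]
    by (auto intro!: linearI simp: matrix_matrix_mult_def vec_eq_iff sum_2 algebra_simps)
  have "A ** mat_pow (r *\<^sub>R A) n = mat_pow (r *\<^sub>R A) n ** A" for n
    by (simp add: mat_pow_scaleR mat_pow_commute linear_scale[OF bounded_linear.linear[OF l]]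
        linear_scale[OF bounded_linear.linear[OF r]])
  then have "(\<lambda>n. A ** (mat_pow (r *\<^sub>R A) n /\<^sub>R fact n)) =
      (\<lambda>n. (mat_pow (r *\<^sub>R A) n /\<^sub>R fact n) ** A)"
    by (simp add: linear_scale[OF bounded_linear.linear[OF l]]
        linear_scale[OF bounded_linear.linear[OF r]])
  with bounded_linear.sums[OF l mat_exp_sums, of "r *\<^sub>R A"]
  have "(\<lambda>n. (mat_pow (r *\<^sub>R A) n /\<^sub>R fact n) ** A) sums (A ** mat_exp (r *\<^sub>R A))"
    by (simp only:)
  from sums_unique2[OF bounded_linear.sums[OF r mat_exp_sums, of "r *\<^sub>R A"] this]
  show ?thesis .
qed

text \<open>
  Along a solution \<open>s \<mapsto> T(t,s) x s\<close> is constant: its derivative is \<open>- A T(t,s) x s + T(t,s) A x s\<close>,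
  which vanishes because \<open>A\<close> commutes with its exponential. The case \<open>t \<le> s\<close>, where the present
  state is recovered from a later one, is the one to which an exponential expansion applies.
\<close>

lemma solution_eq_evolution:
  assumes x: "is_solution A x" and "0 \<le> t" "0 \<le> s"
  shows "x t = evolution A t s *v x s"
proof -
  \<comment> \<open>The evolution family depends on \<open>t - s\<close> alone, so its derivative in the second argument follows
    from the one in the first by the chain rule.\<close>
  define E where "E = (\<lambda>r. evolution A r 0)"
  have E: "E (a - b) = evolution A a b" for a b
    by (simp add: E_def evolution_def)
  have E0: "E 0 = mat 1"
    using E[of 0 0] by (simp add: evolution_refl)
  have deriv: "((\<lambda>s. E (t - s) *v x s) has_vector_derivative 0) (at s within {0..})" if "s \<in> {0..}" for s
  proof -
    have "((\<lambda>s. t - s) has_vector_derivative - 1) (at s within {0..})"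
      by (auto intro!: derivative_eq_intros)
    moreover have "(E has_vector_derivative A ** E (t - s)) (at (t - s) within (\<lambda>s. t - s) ` {0..})"
      unfolding E_def by (rule has_vector_derivative_at_within[OF evolution_has_vector_derivative])
    ultimately have "(E \<circ> (\<lambda>s. t - s) has_vector_derivative (- 1) *\<^sub>R (A ** E (t - s)))
        (at s within {0..})"
      by (rule vector_diff_chain_within)
    then have d: "((\<lambda>s. E (t - s)) has_vector_derivative - (A ** E (t - s))) (at s within {0..})"
      by (simp add: o_def)
    have "(x has_vector_derivative A *v x s) (at s within {0..})"
      using x that by (simp add: is_solution_def)
    from bounded_bilinear.has_vector_derivative[OF bounded_bilinear_matrix_vector_mult d this]
    show ?thesis
      by (simp add: matrix_vector_mul_assoc E_def evolution_def mat_exp_commute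
          bounded_bilinear.minus_left[OF bounded_bilinear_matrix_vector_mult])
  qed
  have "\<exists>c. \<forall>s\<in>{0..}. E (t - s) *v x s = c"
    by (rule has_vector_derivative_zero_constant[OF convex_real_interval(1) deriv]) blast+
  then obtain c where "\<And>s. s \<in> {0..} \<Longrightarrow> E (t - s) *v x s = c"
    by blast
  from this[of s] this[of t] assms show ?thesis
    by (simp add: E E0)
qed

text \<open>
  Reading \<open>max_norm (x t) \<le> D * exp (- \<mu> * (s - t)) * max_norm (x s)\<close> as a lower bound on the later
  value \<open>x s\<close> turns the decay of \<open>T(t,s)\<close> into exponential growth of the solution.
\<close>

lemma solution_blow_up:
  assumes "exponential_expansion A" and x: "is_solution A x" and "0 \<le> t" "x t \<noteq> 0"
  shows "filterlim (\<lambda>s. max_norm (x s)) at_top at_top"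
proof -
  obtain D \<mu> where "D > 0" "\<mu> > 0" and
    exp: "\<And>t s. 0 \<le> t \<Longrightarrow> t \<le> s \<Longrightarrow> max_opnorm (evolution A t s) \<le> D * exp (- \<mu> * (s - t))"
    using assms(1) by (auto simp: exponential_expansion_def)
  have "max_norm (x t) / D * exp (\<mu> * (s - t)) \<le> max_norm (x s)" if "t \<le> s" for s
  proof -
    have "max_norm (x t) = max_norm (evolution A t s *v x s)"
      using solution_eq_evolution[OF x \<open>0 \<le> t\<close>, of s] that \<open>0 \<le> t\<close> by simp
    also have "\<dots> \<le> max_opnorm (evolution A t s) * max_norm (x s)"
      by (rule max_norm_matrix_vector)
    also have "\<dots> \<le> D * exp (- \<mu> * (s - t)) * max_norm (x s)"
      using that \<open>0 \<le> t\<close> by (intro mult_right_mono exp) auto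
    finally have "max_norm (x t) / D * exp (\<mu> * (s - t)) \<le>
        D * exp (- \<mu> * (s - t)) * max_norm (x s) / D * exp (\<mu> * (s - t))"
      using \<open>D > 0\<close> by (intro mult_right_mono divide_right_mono) auto
    also have "\<dots> = max_norm (x s) * (exp (- (\<mu> * (s - t))) * exp (\<mu> * (s - t)))"
      using \<open>D > 0\<close> by simp
    also have "\<dots> = max_norm (x s)"
      by (simp flip: exp_add)
    finally show ?thesis .
  qed
  then have ev: "\<forall>\<^sub>F s in at_top. max_norm (x t) / D * exp (\<mu> * (s - t)) \<le> max_norm (x s)"
    by (rule eventually_at_top_linorderI)
  have lim: "filterlim (\<lambda>s. \<mu> * (s - t)) at_top at_top"
    using filterlim_tendsto_pos_mult_at_top[OF tendsto_const \<open>\<mu> > 0\<close>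
        filterlim_tendsto_add_at_top[OF tendsto_const[of "- t"] filterlim_ident]]
    by simp
  have "0 < max_norm (x t) / D"
    using max_norm_pos[OF \<open>x t \<noteq> 0\<close>] \<open>D > 0\<close> by simp
  then have "filterlim (\<lambda>s. max_norm (x t) / D * exp (\<mu> * (s - t))) at_top at_top"
    by (intro filterlim_tendsto_pos_mult_at_top[OF tendsto_const]
        filterlim_compose[OF exp_at_top] lim)
  from filterlim_at_top_mono[OF this ev] show ?thesis .
qed

section \<open>Lower bounds for norms on the half-line\<close>

lemma emeasure_halfline_interval:
  assumes "0 \<le> a" "a \<le> b"
  shows "emeasure (lebesgue_on {0..}) {a..b} = ennreal (b - a)"
  using assms by (subst emeasure_restrict_space) auto

lemma interval_sets_halfline: "0 \<le> (a::real) \<Longrightarrow> {a..b} \<in> sets (lebesgue_on {0..})"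
  by (auto simp: sets_restrict_space intro!: image_eqI[of _ _ "{a..b}"])

lemma esssup_ge_on_interval:
  fixes f :: "real \<Rightarrow> ennreal"
  assumes "0 \<le> a" "a < b" and ge: "\<And>t. t \<in> {a..b} \<Longrightarrow> c \<le> f t"
  shows "c \<le> esssup (lebesgue_on {0..}) f"
proof (rule ccontr)
  let ?M = "lebesgue_on {0::real..}"
  assume "\<not> c \<le> esssup ?M f"
  then have less: "esssup ?M f < c" by simp
  \<comment> \<open>The essential supremum of a non-measurable function is the top element, so it is not below \<open>c\<close>.\<close>
  then have [measurable]: "f \<in> borel_measurable ?M"
    using esssup_non_measurable[of f ?M] by (metis top.not_eq_extremum top_greatest leD)
  have "ennreal (b - a) = emeasure ?M {a..b}"
    using assms by (simp add: emeasure_halfline_interval)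
  also have "\<dots> \<le> emeasure ?M {t \<in> space ?M. esssup ?M f < f t}"
  proof (rule emeasure_mono)
    show "{a..b} \<subseteq> {t \<in> space ?M. esssup ?M f < f t}"
      using assms(1) ge less by (auto intro: less_le_trans)
    show "{t \<in> space ?M. esssup ?M f < f t} \<in> sets ?M" by measurable
  qed
  also have "\<dots> = 0" by (rule esssup_zero_measure)
  finally show False using \<open>a < b\<close> by simp
qed

lemma ennreal_eq_infinityI:
  assumes "\<And>n. of_nat n \<le> (x :: ennreal)"
  shows "x = \<infinity>"
proof (rule ccontr)
  assume "x \<noteq> \<infinity>"
  then obtain n where "x < of_nat n"
    using ennreal_Ex_less_of_nat[of x] by (auto simp: less_top)
  with assms[of n] show False by simp
qed

text \<open>
  Both cases compare \<open>f\<close> with a constant on a bounded interval far out: of length one and with an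
  arbitrarily large constant for the essential supremum, of arbitrary length and with the constant one
  for the integral.
\<close>

lemma Lp_norm_eq_infinity:
  assumes lim: "filterlim (\<lambda>t. max_norm (f t)) at_top at_top"
  shows "Lp_norm p f = \<infinity>"
proof -
  have large: "\<exists>S\<ge>0. \<forall>t\<ge>S. c \<le> max_norm (f t)" for c
  proof -
    obtain S where "\<forall>t\<ge>S. c \<le> max_norm (f t)"
      using lim by (auto simp: filterlim_at_top eventually_at_top_linorder)
    then show ?thesis by (intro exI[of _ "max 0 S"]) auto
  qed
  show ?thesis
  proof (cases "p = \<infinity>")
    case True
    have "of_nat n \<le> Lp_norm p f" for n
    proof -
      obtain S where "S \<ge> 0" "\<forall>t\<ge>S. real n \<le> max_norm (f t)"
        using large by blast
      then show ?thesis
        unfolding Lp_norm_def using True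
        by (auto intro!: esssup_ge_on_interval[of S "S + 1"] simp: ennreal_of_nat_eq_real_of_nat)
    qed
    then show ?thesis
      by (rule ennreal_eq_infinityI)
  next
    case False
    define I where "I = (\<integral>\<^sup>+ t. ennreal (max_norm (f t) powr enn2real p) \<partial>lebesgue_on {0..})"
    obtain S where S: "S \<ge> 0" "\<forall>t\<ge>S. 1 \<le> max_norm (f t)"
      using large by blast
    have "of_nat n \<le> I" for n
    proof -
      have "of_nat n = emeasure (lebesgue_on {0..}) {S..S + real n}"
        using S(1) by (simp add: emeasure_halfline_interval ennreal_of_nat_eq_real_of_nat)
      also have "\<dots> = (\<integral>\<^sup>+ t. indicator {S..S + real n} t \<partial>lebesgue_on {0..})"
        using S(1) by (simp add: interval_sets_halfline)
      also have "\<dots> \<le> I"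
        unfolding I_def using S(2)
        by (intro nn_integral_mono) (auto simp: indicator_def ge_one_powr_ge_zero)
      finally show ?thesis .
    qed
    then have "I = \<infinity>" by (rule ennreal_eq_infinityI)
    then show ?thesis
      using False by (simp add: Lp_norm_def I_def)
  qed
qed

lemma Lp_norm_cong:
  assumes "\<And>t. 0 \<le> t \<Longrightarrow> max_norm (f t) = max_norm (g t)"
  shows "Lp_norm p f = Lp_norm p g"
proof -
  have i: "(\<integral>\<^sup>+ t. ennreal (max_norm (f t) powr enn2real p) \<partial>lebesgue_on {0..}) =
      (\<integral>\<^sup>+ t. ennreal (max_norm (g t) powr enn2real p) \<partial>lebesgue_on {0..})"
    using assms by (intro nn_integral_cong) auto
  have "(\<lambda>t. ennreal (max_norm (f t))) \<in> borel_measurable (lebesgue_on {0..}) \<longleftrightarrow>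
      (\<lambda>t. ennreal (max_norm (g t))) \<in> borel_measurable (lebesgue_on {0..})"
    using assms by (intro measurable_cong) auto
  then have "esssup (lebesgue_on {0..}) (\<lambda>t. ennreal (max_norm (f t))) =
      esssup (lebesgue_on {0..}) (\<lambda>t. ennreal (max_norm (g t)))"
    using assms
    by (cases "(\<lambda>t. ennreal (max_norm (f t))) \<in> borel_measurable (lebesgue_on {0..})")
       (auto intro!: esssup_AE_cong simp: esssup_non_measurable)
  with i show ?thesis by (simp add: Lp_norm_def)
qed

section \<open>Norms of decaying exponentials\<close>

text \<open>
  The \<open>L\<^sup>p\<close> norm of the scalar function \<open>t \<mapsto> exp (- \<gamma> * t)\<close> on the half-line, for \<open>\<gamma> > 0\<close>. The value at
  \<open>p = \<infinity>\<close> is the limit of the others as \<open>p\<close> tends to infinity, but \<open>enn2real \<infinity> = 0\<close> makes a separate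
  case necessary.
\<close>

definition exp_decay_norm :: "ennreal \<Rightarrow> real \<Rightarrow> real" where
  "exp_decay_norm p \<gamma> = (if p = \<infinity> then 1 else 1 / (enn2real p * \<gamma>) powr (1 / enn2real p))"

lemma enn2real_ge_one: "1 \<le> p \<Longrightarrow> p \<noteq> \<infinity> \<Longrightarrow> 1 \<le> enn2real p"
  by (cases p) auto

lemma exp_decay_norm_pos: "1 \<le> p \<Longrightarrow> \<gamma> > 0 \<Longrightarrow> exp_decay_norm p \<gamma> > 0"
  using enn2real_ge_one[of p] by (auto simp: exp_decay_norm_def)

lemma borel_measurable_exp_decay:
  "(\<lambda>t. exp (- \<gamma> * t) *\<^sub>R v) \<in> borel_measurable (lebesgue_on {0..})"
  for v :: "complex^2"
  by (intro continuous_imp_measurable_on_sets_lebesgue continuous_intros) auto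

text \<open>
  For finite \<open>p\<close> this is the integral of \<open>exp (- p * \<gamma> * t)\<close>. For \<open>p = \<infinity>\<close> the supremum is the value at
  \<open>t = 0\<close>, a null set; it is approached on the intervals from \<open>0\<close> to \<open>\<delta>\<close>, where the function is at least
  \<open>exp (- \<gamma> * \<delta>) * max_norm v\<close>.
\<close>

lemma Lp_norm_exp_decay:
  assumes "1 \<le> p" "\<gamma> > 0"
  shows "Lp_norm p (\<lambda>t. exp (- \<gamma> * t) *\<^sub>R v) = ennreal (max_norm v * exp_decay_norm p \<gamma>)"
proof (cases "p = \<infinity>")
  case True
  let ?f = "\<lambda>t. ennreal (max_norm (exp (- \<gamma> * t) *\<^sub>R v))"
  have meas: "?f \<in> borel_measurable (lebesgue_on {0..})"
    using borel_measurable_exp_decay[of \<gamma> v] by measurable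
  have "esssup (lebesgue_on {0..}) ?f \<le> ennreal (max_norm v)"
    using \<open>\<gamma> > 0\<close>
    by (intro esssup_I meas AE_I2) (auto simp: max_norm_scaleR intro!: ennreal_leI mult_left_le_one_le)
  moreover have "ennreal (max_norm v) \<le> esssup (lebesgue_on {0..}) ?f"
  proof (rule tendsto_upperbound)
    have "((\<lambda>\<delta>. exp (- \<gamma> * \<delta>) * max_norm v) \<longlongrightarrow> exp (- \<gamma> * 0) * max_norm v) (at_right 0)"
      by (intro tendsto_intros)
    then show "((\<lambda>\<delta>. ennreal (exp (- \<gamma> * \<delta>) * max_norm v)) \<longlongrightarrow> ennreal (max_norm v)) (at_right 0)"
      by (intro tendsto_ennrealI) simp
    have "ennreal (exp (- \<gamma> * \<delta>) * max_norm v) \<le> esssup (lebesgue_on {0..}) ?f" if "\<delta> > 0" for \<delta>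
      using that \<open>\<gamma> > 0\<close>
      by (intro esssup_ge_on_interval[of 0 \<delta>])
         (auto simp: max_norm_scaleR intro!: ennreal_leI mult_right_mono)
    then show "\<forall>\<^sub>F \<delta> in at_right 0. ennreal (exp (- \<gamma> * \<delta>) * max_norm v) \<le> esssup (lebesgue_on {0..}) ?f"
      by (auto simp: eventually_at_right_field intro: exI[of _ 1])
  qed simp
  ultimately show ?thesis
    using True by (simp add: Lp_norm_def exp_decay_norm_def)
next
  case False
  define r where "r = enn2real p"
  have r: "r \<ge> 1" using enn2real_ge_one[OF assms(1) False] by (simp add: r_def)
  let ?c = "max_norm v powr r"
  have "(\<integral>\<^sup>+ t. ennreal (max_norm (exp (- \<gamma> * t) *\<^sub>R v) powr r) \<partial>lebesgue_on {0..})
      = (\<integral>\<^sup>+ t\<in>{0..}. ennreal (?c * exp (- (r * \<gamma>) * t)) \<partial>lebesgue)"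
    by (subst nn_integral_restrict_space)
       (auto simp: max_norm_scaleR powr_mult exp_powr_real mult_ac)
  also have "\<dots> = (\<integral>\<^sup>+ t\<in>{0..}. ennreal (?c * exp (- (r * \<gamma>) * t)) \<partial>lborel)"
    by (rule nn_integral_completion)
  also have "\<dots> = ennreal (0 - - (?c / (r * \<gamma>)) * exp (- (r * \<gamma>) * 0))"
  proof (rule nn_integral_FTC_atLeast)
    show "((\<lambda>t. - (?c / (r * \<gamma>)) * exp (- (r * \<gamma>) * t)) has_real_derivative ?c * exp (- (r * \<gamma>) * t)) (at t)" for t
      using r \<open>\<gamma> > 0\<close> by (auto intro!: derivative_eq_intros)
    have "filterlim (\<lambda>t. - (r * \<gamma>) * t) at_bot at_top"
      using r \<open>\<gamma> > 0\<close> by (intro filterlim_tendsto_neg_mult_at_bot[OF tendsto_const _ filterlim_ident]) auto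
    from tendsto_mult_right_zero[OF filterlim_compose[OF exp_at_bot this]]
    show "((\<lambda>t. - (?c / (r * \<gamma>)) * exp (- (r * \<gamma>) * t)) \<longlongrightarrow> 0) at_top" .
  qed auto
  finally have I: "(\<integral>\<^sup>+ t. ennreal (max_norm (exp (- \<gamma> * t) *\<^sub>R v) powr r) \<partial>lebesgue_on {0..})
      = ennreal (?c / (r * \<gamma>))" by simp
  have "(?c / (r * \<gamma>)) powr (1 / r) = max_norm v * (1 / (r * \<gamma>) powr (1 / r))"
    using r \<open>\<gamma> > 0\<close> by (simp add: powr_divide powr_powr)
  then show ?thesis
    using False r \<open>\<gamma> > 0\<close> I by (simp add: Lp_norm_def exp_decay_norm_def r_def[symmetric])
qed

section \<open>The lower bound\<close>

text \<open>
  The approximate solution \<open>exp (- \<gamma> * t) *\<^sub>R v\<close> has residual \<open>- exp (- \<gamma> * t) *\<^sub>R (\<gamma> *\<^sub>R v + A *v v)\<close>, and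
  the zero solution is the only one at finite distance from it. The residual must not vanish for its
  norm to serve as the error bound \<open>\<epsilon>\<close>, which is positive.
\<close>

lemma HUS_constant_exp_decay_bound:
  fixes v :: "complex^2"
  assumes "1 \<le> p" "1 \<le> q" "exponential_expansion A" "HUS_constant p q A L" "\<gamma> > 0"
    and w: "\<gamma> *\<^sub>R v + A *v v \<noteq> 0"
  shows "max_norm v * exp_decay_norm p \<gamma> \<le> L * (max_norm (\<gamma> *\<^sub>R v + A *v v) * exp_decay_norm q \<gamma>)"
proof -
  define w where "w = \<gamma> *\<^sub>R v + A *v v"
  define y where "y = (\<lambda>t. exp (- \<gamma> * t) *\<^sub>R v)"
  define y' where "y' = (\<lambda>t. (- \<gamma> * exp (- \<gamma> * t)) *\<^sub>R v)"
  define \<epsilon> where "\<epsilon> = max_norm w * exp_decay_norm q \<gamma>"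
  have "\<epsilon> > 0"
    unfolding \<epsilon>_def using assms by (intro mult_pos_pos max_norm_pos exp_decay_norm_pos) (auto simp: w_def)
  have residual: "y' t - A *v y t = exp (- \<gamma> * t) *\<^sub>R (- w)" for t
    by (simp add: y'_def y_def w_def algebra_simps
        bounded_bilinear.scaleR_right[OF bounded_bilinear_matrix_vector_mult])
  have norm_res: "Lp_norm q (\<lambda>t. y' t - A *v y t) = ennreal \<epsilon>"
    unfolding residual \<epsilon>_def using Lp_norm_exp_decay[of q \<gamma> "- w"] assms by simp
  have "(y has_vector_derivative y' t) (at t within {0..})" for t
    unfolding y_def y'_def
    by (auto intro!: derivative_eq_intros has_vector_derivative_scaleR
        simp: has_real_derivative_iff_has_vector_derivative[symmetric])
  moreover have "continuous_on {0..} y'"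
    unfolding y'_def by (intro continuous_intros)
  moreover have "(\<lambda>t. y' t - A *v y t) \<in> Lp_space q"
    using norm_res borel_measurable_exp_decay[of \<gamma> "- w"] by (simp add: Lp_space_def residual)
  ultimately obtain x where x: "is_solution A x" and
    le: "Lp_norm p (\<lambda>t. x t - y t) \<le> ennreal (L * \<epsilon>)"
    using \<open>HUS_constant p q A L\<close> \<open>\<epsilon> > 0\<close> norm_res unfolding HUS_constant_def by fastforce
  have x0: "x t = 0" if "0 \<le> t" for t
  proof (rule ccontr)
    assume "x t \<noteq> 0"
    have "filterlim (\<lambda>s. max_norm (x s - y s)) at_top at_top"
    proof (rule filterlim_at_top_mono)
      show "filterlim (\<lambda>s. - max_norm v + max_norm (x s)) at_top at_top"
        by (intro filterlim_tendsto_add_at_top[OF tendsto_const]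
            solution_blow_up[OF assms(3) x \<open>0 \<le> t\<close> \<open>x t \<noteq> 0\<close>])
      have "- max_norm v + max_norm (x s) \<le> max_norm (x s - y s)" if "0 \<le> s" for s
      proof -
        have "max_norm (y s) \<le> max_norm v"
          using that \<open>\<gamma> > 0\<close> by (auto simp: y_def max_norm_scaleR intro!: mult_left_le_one_le)
        then show ?thesis using max_norm_diff_ge[of "x s" "y s"] by simp
      qed
      then show "\<forall>\<^sub>F s in at_top. - max_norm v + max_norm (x s) \<le> max_norm (x s - y s)"
        by (rule eventually_at_top_linorderI)
    qed
    then show False using Lp_norm_eq_infinity le by (simp add: top_unique)
  qed
  have "ennreal (max_norm v * exp_decay_norm p \<gamma>) = Lp_norm p y"
    unfolding y_def by (rule Lp_norm_exp_decay[symmetric]) fact+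
  also have "\<dots> = Lp_norm p (\<lambda>t. x t - y t)"
    by (rule Lp_norm_cong) (simp add: x0)
  also note le
  finally show ?thesis
    using \<open>HUS_constant p q A L\<close> \<open>\<epsilon> > 0\<close>
    by (simp add: HUS_constant_def ennreal_le_iff \<epsilon>_def w_def)
qed

theorem theorem3:
  fixes p q :: ennreal and A :: "complex^2^2" and L :: real
  assumes "1 \<le> q" and "q \<le> p" and "p \<le> \<infinity>"
    and "invertible A"
    and "exponential_expansion A"
    and "HUS_constant p q A L"
  shows "\<forall>u :: complex^2. \<forall>\<gamma> :: real. max_norm u = 1 \<and> \<gamma> > 0 \<longrightarrow>
    L \<ge> (if p < \<infinity> then
            (max_norm (matrix_inv A *v u) * (enn2real q * \<gamma>) powr (1 / enn2real q)) /
            (max_norm ((\<gamma> *\<^sub>R matrix_inv A + mat 1) *v u) * (enn2real p * \<gamma>) powr (1 / enn2real p))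
          else if q < \<infinity> then
            (max_norm (matrix_inv A *v u) * (enn2real q * \<gamma>) powr (1 / enn2real q)) /
            max_norm ((\<gamma> *\<^sub>R matrix_inv A + mat 1) *v u)
          else
            max_norm (matrix_inv A *v u) / max_norm ((\<gamma> *\<^sub>R matrix_inv A + mat 1) *v u))"
proof (intro allI impI)
  fix u :: "complex^2" and \<gamma> :: real
  assume "max_norm u = 1 \<and> \<gamma> > 0"
  then have "\<gamma> > 0" by simp
  have p: "1 \<le> p" using assms(1,2) by (rule order_trans)
  have pq: "q < \<infinity>" if "p < \<infinity>"
    using assms(2) that by (rule le_less_trans)
  have "L > 0" using assms(6) by (simp add: HUS_constant_def)
  define v where "v = matrix_inv A *v u"
  define w where "w = (\<gamma> *\<^sub>R matrix_inv A + mat 1) *v u"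
  have "A *v v = u"
    using someI_ex[OF assms(4)[unfolded invertible_def]]
    by (simp add: v_def matrix_vector_mul_assoc matrix_inv_def)
  then have w: "w = \<gamma> *\<^sub>R v + A *v v"
    by (simp add: w_def v_def matrix_vector_mult_add_rdistrib
        bounded_bilinear.scaleR_left[OF bounded_bilinear_matrix_vector_mult])
  have "max_norm v * exp_decay_norm p \<gamma> / (max_norm w * exp_decay_norm q \<gamma>) \<le> L"
  proof (cases "w = 0")
    case True
    \<comment> \<open>The quotient is then zero by the convention for division by zero.\<close>
    then show ?thesis using \<open>L > 0\<close> by simp
  next
    case False
    then have "max_norm v * exp_decay_norm p \<gamma> \<le> L * (max_norm w * exp_decay_norm q \<gamma>)"
      unfolding w by (intro HUS_constant_exp_decay_bound p assms \<open>\<gamma> > 0\<close>)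
    then show ?thesis
      using max_norm_pos[OF False] exp_decay_norm_pos[OF assms(1) \<open>\<gamma> > 0\<close>]
      by (simp add: divide_le_eq)
  qed
  then show "L \<ge> (if p < \<infinity> then
            (max_norm (matrix_inv A *v u) * (enn2real q * \<gamma>) powr (1 / enn2real q)) /
            (max_norm ((\<gamma> *\<^sub>R matrix_inv A + mat 1) *v u) * (enn2real p * \<gamma>) powr (1 / enn2real p))
          else if q < \<infinity> then
            (max_norm (matrix_inv A *v u) * (enn2real q * \<gamma>) powr (1 / enn2real q)) /
            max_norm ((\<gamma> *\<^sub>R matrix_inv A + mat 1) *v u)
          else
            max_norm (matrix_inv A *v u) / max_norm ((\<gamma> *\<^sub>R matrix_inv A + mat 1) *v u))"
    using pq unfolding v_def[symmetric] w_def[symmetric]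
    by (cases "p = \<infinity>"; cases "q = \<infinity>")
       (simp_all add: exp_decay_norm_def less_top[symmetric] mult_ac)
qed
end
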